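(* Let $1\le p<\infty$ and let $f:[0,1]\to\mathbb{R}$ belong to $BV_p$. There is a constant $C>0$ such that for every sequence $\mathbf{x}=\{x_n\}_{n=1}^\infty\subset[0,1]$ and all $N\in\mathbb{N}$ there holds $$\mathcal{E}_N(f;\mathbf{x})\le C N^{1-1/p}D_N^*(\mathbf{x})\,\mathrm{Var}_p(f).$$
   Context: Here $\mathbb{N}=\{1,2,3,\dots\}$. For a sequence $\mathbf{x}=\{x_n\}_{n=1}^\infty\subset[0,1]$ and $f:[0,1]\to\mathbb{R}$, the quadrature error is $$\mathcal{E}_N(f;\mathbf{x})=\left|\frac1N\sum_{n=1}^N f(x_n)-\int_0^1 f(t)\,dt\right|.$$ For $E\subset[0,1]$ let $A_N(E,\mathbf{x})=\sum_{n=1}^N\chi_E(x_n)$, where $\chi_E$ is the indicator function of $E$ (the number of indices $1\le n\le N$ with $x_n\in E$). The star discrepancy is $$D_N^*(\mathbf{x})=\sup_{0<b\le1}\left|\frac{A_N([0,b),\mathbf{x})}{N}-b\right|.$$ For an interval $I=[a,b]\subset[0,1]$ write $f(I)=f(b)-f(a)$. The total $p$-variation of $f$ is $$\mathrm{Var}_p(f)=\sup\left(\sum_{j=1}^\infty|f(I_j)|^p\right)^{1/p},$$ where the supremum is taken over all collections $\{I_j\}_{j=1}^\infty$ of non-overlapping intervals contained in $[0,1]$ (non-overlapping: disjoint interiors). One writes $f\in BV_p$ if $\mathrm{Var}_p(f)<\infty$. *)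

theory Defs
  imports "HOL-Analysis.Analysis"
begin

text \<open>
  Functions on the unit interval are total functions of type \<open>real \<Rightarrow> real\<close> of which only
  the values on \<open>{0..1}\<close> are used. Sequences are indexed from 1; the value at index 0 is ignored.
\<close>

text \<open>The integral is the gauge integral; a function of bounded \<open>p\<close>-variation is regulated on
  \<open>{0..1}\<close>, so for such functions this is the Riemann integral.\<close>

definition quad_error :: "nat \<Rightarrow> (real \<Rightarrow> real) \<Rightarrow> (nat \<Rightarrow> real) \<Rightarrow> real" where
  "quad_error N f x = \<bar>(\<Sum>n=1..N. f (x n)) / real N - integral {0..1} f\<bar>"

definition hits :: "nat \<Rightarrow> real set \<Rightarrow> (nat \<Rightarrow> real) \<Rightarrow> real" where
  "hits N E x = (\<Sum>n=1..N. indicator E (x n))"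

definition star_discrepancy :: "nat \<Rightarrow> (nat \<Rightarrow> real) \<Rightarrow> real" where
  "star_discrepancy N x = (SUP b\<in>{0<..1}. \<bar>hits N {0..<b} x / real N - b\<bar>)"

text \<open>The \<open>j\<close>-th interval is \<open>{a j..b j}\<close>. Degenerate intervals are allowed; they contribute
  nothing to the variation sums, so finite collections are covered by padding.\<close>

definition nonoverlapping :: "(nat \<Rightarrow> real) \<Rightarrow> (nat \<Rightarrow> real) \<Rightarrow> bool" where
  "nonoverlapping a b \<longleftrightarrow>
     (\<forall>j. a j \<le> b j \<and> {a j..b j} \<subseteq> {0..1}) \<and>
     (\<forall>i j. i \<noteq> j \<longrightarrow> interior {a i..b i} \<inter> interior {a j..b j} = {})"

definition variation_sum ::
    "real \<Rightarrow> (real \<Rightarrow> real) \<Rightarrow> (nat \<Rightarrow> real) \<Rightarrow> (nat \<Rightarrow> real) \<Rightarrow> ereal" where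
  "variation_sum p f a b =
     (if summable (\<lambda>j. \<bar>f (b j) - f (a j)\<bar> powr p)
      then ereal ((\<Sum>j. \<bar>f (b j) - f (a j)\<bar> powr p) powr (1 / p))
      else \<infinity>)"

definition Var :: "real \<Rightarrow> (real \<Rightarrow> real) \<Rightarrow> ereal" where
  "Var p f = Sup {variation_sum p f a b | a b. nonoverlapping a b}"

definition BV :: "real \<Rightarrow> (real \<Rightarrow> real) set" where
  "BV p = {f. Var p f < \<infinity>}"

end

theory Submission
  imports Defs
begin

text \<open>
  The \<open>p\<close>-th power variation \<open>V t\<close> of \<open>f\<close> on \<open>[0, t]\<close> is a nondecreasing function
  bounded by \<open>Var\<^sub>p(f)\<^sup>p\<close> with \<open>\<bar>f t - f s\<bar>\<^sup>p \<le> V t - V s\<close> for \<open>s \<le> t\<close>. In particular \<open>f\<close> has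
  countably many discontinuities and is integrable. Let \<open>y\<^sub>0 \<le> \<dots> \<le> y\<^bsub>N-1\<^esub>\<close> be the sorted points.
  Both \<open>y\<^sub>i\<close> and the cell \<open>[i/N, (i+1)/N]\<close> lie in the interval of radius \<open>D = D\<^sub>N\<^sup>*\<close>
  around the midpoint \<open>c\<^sub>i\<close> of the cell. With \<open>m = \<lceil>2ND\<rceil> \<le> 4ND\<close> we have \<open>c\<^sub>i + D \<le> c\<^bsub>i+m\<^esub> - D\<close>, so the
  cell contributes at most \<open>s\<^sub>i\<^bsup>1/p\<^esup>/N\<close> to the error, where \<open>s\<^sub>i = V(c\<^bsub>i+m\<^esub> - D) - V(c\<^sub>i - D)\<close>.
  The \<open>s\<^sub>i\<close> add up to at most \<open>m Var\<^sub>p(f)\<^sup>p\<close> by telescoping, and concavity of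
  \<open>u \<mapsto> u\<^bsup>1/p\<^esup>\<close> bounds the error by \<open>(m/N)\<^bsup>1/p\<^esup> Var\<^sub>p(f)\<close>. Since \<open>m/N \<ge> 1/N\<close>, this is at most
  \<open>(m/N) N\<^bsup>1-1/p\<^esup> Var\<^sub>p(f) \<le> 4 D N\<^bsup>1-1/p\<^esup> Var\<^sub>p(f)\<close>.
\<close>

section \<open>Power variation and increments\<close>

lemma Var_nonneg: "0 \<le> Var p f"
proof -
  have "nonoverlapping (\<lambda>_. 0) (\<lambda>_. 0)"
    by (auto simp: nonoverlapping_def)
  then have "variation_sum p f (\<lambda>_. 0) (\<lambda>_. 0) \<le> Var p f"
    unfolding Var_def by (intro Sup_upper) blast
  then show ?thesis
    by (simp add: variation_sum_def zero_ereal_def)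
qed

text \<open>Replaces the extended-real supremum over infinite collections by a real bound on finite
  families. The \<open>p\<close>-th root is removed so that contributions of separate intervals
  add.\<close>

lemma sum_powr_le_Var:
  fixes a b :: "nat \<Rightarrow> real"
  assumes p: "1 \<le> p" and v: "Var p f = ereal v"
    and ab: "\<And>i. i < n \<Longrightarrow> 0 \<le> a i \<and> a i \<le> b i \<and> b i \<le> 1"
    and disj: "\<And>i j. i < n \<Longrightarrow> j < n \<Longrightarrow> i \<noteq> j \<Longrightarrow> {a i<..<b i} \<inter> {a j<..<b j} = {}"
  shows "(\<Sum>i<n. \<bar>f (b i) - f (a i)\<bar> powr p) \<le> v powr p"
proof -
  \<comment> \<open>The padding intervals are all \<open>{0..0}\<close>, with empty interior and
    zero increment.\<close>
  define a' where "a' i = (if i < n then a i else 0)" for i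
  define b' where "b' i = (if i < n then b i else 0)" for i
  let ?g = "\<lambda>j. \<bar>f (b' j) - f (a' j)\<bar> powr p"
  let ?S = "\<Sum>i<n. \<bar>f (b i) - f (a i)\<bar> powr p"
  have no: "nonoverlapping a' b'"
    unfolding nonoverlapping_def interior_atLeastAtMost_real
  proof (intro conjI allI impI)
    fix i j :: nat assume "i \<noteq> j"
    then show "{a' i<..<b' i} \<inter> {a' j<..<b' j} = {}"
      using disj[of i j] by (cases "i < n"; cases "j < n") (auto simp: a'_def b'_def)
  qed (use ab in \<open>auto simp: a'_def b'_def intro: order_trans\<close>)
  have z: "?g j = 0" if "j \<notin> {..<n}" for j
    using that by (simp add: a'_def b'_def)
  have "summable ?g"
    by (rule summable_finite[of "{..<n}"]) (use z in auto)
  moreover have "(\<Sum>j. ?g j) = (\<Sum>j<n. ?g j)"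
    by (rule suminf_finite) (use z in auto)
  moreover have "\<dots> = ?S"
    by (intro sum.cong) (auto simp: a'_def b'_def)
  ultimately have "variation_sum p f a' b' = ereal (?S powr (1 / p))"
    by (simp add: variation_sum_def)
  moreover have "variation_sum p f a' b' \<le> Var p f"
    unfolding Var_def using no by (intro Sup_upper) blast
  ultimately have "?S powr (1 / p) \<le> v"
    using v by simp
  then have "(?S powr (1 / p)) powr p \<le> v powr p"
    using p by (intro powr_mono2) auto
  then show ?thesis
    using p by (simp add: powr_powr sum_nonneg)
qed

text \<open>Appending \<open>{s..t}\<close> to any finite family inside \<open>{0..s}\<close> gives
  a family inside \<open>{0..t}\<close> and adds exactly the \<open>p\<close>-th power of the new
  increment; the last bound follows on taking suprema.\<close>

lemma BV_increment_bound:
  assumes p: "1 \<le> p" and v: "Var p f = ereal v"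
  obtains V :: "real \<Rightarrow> real" where "mono V" and "\<And>t. 0 \<le> V t" and "\<And>t. V t \<le> v powr p"
    and "\<And>s t. 0 \<le> s \<Longrightarrow> s \<le> t \<Longrightarrow> t \<le> 1 \<Longrightarrow> \<bar>f t - f s\<bar> powr p \<le> V t - V s"
proof -
  \<comment> \<open>The cap \<open>b i \<le> 1\<close> makes \<open>V\<close> meaningful for every
    real \<open>t\<close>: it vanishes for \<open>t < 0\<close> and is constant beyond 1. Later it
    is evaluated at window ends that may leave the unit interval.\<close>
  define adm where "adm t n a b \<longleftrightarrow>
      (\<forall>i<n. 0 \<le> a i \<and> a i \<le> b i \<and> b i \<le> 1 \<and> b i \<le> t) \<and>
      (\<forall>i<n. \<forall>j<n. i \<noteq> j \<longrightarrow> {a i<..<b i} \<inter> {a j<..<b j} = {})"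
    for t :: real and n :: nat and a b :: "nat \<Rightarrow> real"
  define S where "S n a b = (\<Sum>i<n. \<bar>f (b i) - f (a i)\<bar> powr p)" for n :: nat and a b
  define Z where "Z t = {S n a b | n a b. adm t n a b}" for t
  define V where "V t = Sup (Z t)" for t
  have le: "z \<le> v powr p" if "z \<in> Z t" for z t
  proof -
    obtain n a b where z: "z = S n a b" and adm: "adm t n a b"
      using \<open>z \<in> Z t\<close> unfolding Z_def by blast
    show ?thesis
      unfolding z S_def by (rule sum_powr_le_Var[OF p v]) (use adm in \<open>simp_all add: adm_def\<close>)
  qed
  have bdd: "bdd_above (Z t)" for t
    using le by (meson bdd_aboveI)
  have zero: "0 \<in> Z t" for t
  proof -
    have "adm t 0 (\<lambda>_. 0) (\<lambda>_. 0)" and "0 = S 0 (\<lambda>_. 0) (\<lambda>_. 0)"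
      by (simp_all add: adm_def S_def)
    then show ?thesis
      unfolding Z_def by blast
  qed
  show thesis
  proof
    show "mono V"
      unfolding mono_def V_def
    proof (intro allI impI cSup_subset_mono bdd)
      fix s t :: real assume "s \<le> t"
      then have "adm t n a b" if "adm s n a b" for n a b
        using that unfolding adm_def by (meson order_trans)
      then show "Z s \<subseteq> Z t"
        unfolding Z_def by blast
    qed (use zero in auto)
    show "0 \<le> V t" for t
      unfolding V_def using zero bdd by (intro cSup_upper) auto
    show "V t \<le> v powr p" for t
      unfolding V_def using zero le by (intro cSup_least) auto
    fix s t :: real assume st: "0 \<le> s" "s \<le> t" "t \<le> 1"
    have "z + \<bar>f t - f s\<bar> powr p \<le> V t" if zs: "z \<in> Z s" for z
    proof -
      obtain n a b where z: "z = S n a b" and adm: "adm s n a b"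
        using zs unfolding Z_def by blast
      let ?a = "a(n := s)" and ?b = "b(n := t)"
      have "S (Suc n) ?a ?b = z + \<bar>f t - f s\<bar> powr p"
        unfolding z S_def by simp
      moreover have "adm t (Suc n) ?a ?b"
      proof -
        have ab: "0 \<le> a i" "a i \<le> b i" "b i \<le> 1" "b i \<le> s" if "i < n" for i
          using adm that unfolding adm_def by auto
        have disj: "{a i<..<b i} \<inter> {a j<..<b j} = {}" if "i < n" "j < n" "i \<noteq> j" for i j
          using adm that unfolding adm_def by blast
        have new: "{a i<..<b i} \<inter> {s<..<t} = {}" if "i < n" for i
          using ab(4)[OF that] by auto
        show ?thesis
          unfolding adm_def
        proof (intro conjI allI impI)
          fix i j assume "i < Suc n" "j < Suc n" "i \<noteq> j"
          then consider "i < n" "j < n" | "i < n" "j = n" | "i = n" "j < n"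
            by linarith
          then show "{?a i<..<?b i} \<inter> {?a j<..<?b j} = {}"
          proof cases
            case 1
            then show ?thesis using disj \<open>i \<noteq> j\<close> by simp
          next
            case 2
            then show ?thesis using new[of i] by simp
          next
            case 3
            then show ?thesis using new[of j] by (subst Int_commute) simp
          qed
        next
          fix i assume i: "i < Suc n"
          show "0 \<le> ?a i" "?a i \<le> ?b i" "?b i \<le> 1" "?b i \<le> t"
            using ab[of i] i st by (cases "i = n"; simp)+
        qed
      qed
      ultimately have "z + \<bar>f t - f s\<bar> powr p \<in> Z t"
        unfolding Z_def mem_Collect_eq by (intro exI[of _ "Suc n"] exI[of _ ?a] exI[of _ ?b]) simp
      then show ?thesis
        unfolding V_def using bdd by (intro cSup_upper)
    qed
    then have "V s \<le> V t - \<bar>f t - f s\<bar> powr p"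
      unfolding V_def[of s] using zero by (intro cSup_least) (auto simp: algebra_simps)
    then show "\<bar>f t - f s\<bar> powr p \<le> V t - V s"
      by simp
  qed
qed

section \<open>Integrability\<close>

text \<open>On the unit interval \<open>f\<close> is continuous wherever \<open>V\<close> is, and a
  monotone \<open>V\<close> has countably many discontinuities. So \<open>f\<close> is measurable
  there; being bounded as well, it is integrable.\<close>

lemma integrable_increment_bound:
  fixes V f :: "real \<Rightarrow> real"
  assumes p: "1 \<le> p" and mono: "mono V"
    and inc: "\<And>s t. 0 \<le> s \<Longrightarrow> s \<le> t \<Longrightarrow> t \<le> 1 \<Longrightarrow> \<bar>f t - f s\<bar> powr p \<le> V t - V s"
  shows "f integrable_on {0..1}"
proof -
  \<comment> \<open>Freezing \<open>f\<close> at its end values makes the increment bound hold for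
    all real \<open>s \<le> t\<close>, so that 0 and 1 are treated like interior points.\<close>
  define g where "g t = f (max 0 (min 1 t))" for t
  have le: "\<bar>g t - g s\<bar> powr p \<le> V t - V s" if "s \<le> t" for s t
  proof (cases "t < 0 \<or> 1 < s")
    case True
    then have "g t = g s"
      using that by (auto simp: g_def)
    then show ?thesis
      using that mono by (simp add: monoD)
  next
    case False
    then have "V s \<le> V (max 0 (min 1 s))" "V (max 0 (min 1 t)) \<le> V t"
      by (auto intro!: monoD[OF mono])
    then show ?thesis
      using inc[of "max 0 (min 1 s)" "max 0 (min 1 t)"] that unfolding g_def by fastforce
  qed
  have abs_le: "\<bar>g t - g s\<bar> \<le> \<bar>V t - V s\<bar> powr (1 / p)" for s t
  proof -
    have "\<bar>g t - g s\<bar> powr p \<le> \<bar>V t - V s\<bar>"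
      using le[of s t] le[of t s] by (cases "s \<le> t") (auto simp: abs_minus_commute)
    then have "(\<bar>g t - g s\<bar> powr p) powr (1 / p) \<le> \<bar>V t - V s\<bar> powr (1 / p)"
      using p by (intro powr_mono2) auto
    then show ?thesis
      using p by (simp add: powr_powr)
  qed
  have "isCont g s" if "isCont V s" for s
  proof -
    have "(V \<longlongrightarrow> V s) (at s)"
      using that by (simp add: isCont_def)
    then have "((\<lambda>t. \<bar>V t - V s\<bar>) \<longlongrightarrow> 0) (at s)"
      by (intro tendsto_eq_intros | simp)+
    then have "((\<lambda>t. \<bar>V t - V s\<bar> powr (1 / p)) \<longlongrightarrow> 0) (at s)"
      using p tendsto_zero_powrI[of _ "at s" "\<lambda>_. 1 / p" "1 / p"] by simp
    then have "((\<lambda>t. g t - g s) \<longlongrightarrow> 0) (at s)"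
      by (rule Lim_null_comparison[rotated]) (use abs_le in simp)
    then show ?thesis
      unfolding isCont_def by (simp add: LIM_zero_iff)
  qed
  then have "continuous_on (- {s. \<not> isCont V s}) g"
    by (auto intro: continuous_at_imp_continuous_on)
  then have "g \<in> borel_measurable borel"
    using mono_ctble_discont[OF mono] by (rule borel_measurable_continuous_countable_exceptions[rotated])
  then have "g \<in> borel_measurable (lebesgue_on {0..1})"
    by (intro measurable_restrict_space1 measurable_completion) simp
  moreover have "\<bar>g t\<bar> \<le> \<bar>g 0\<bar> + (V 1 - V 0) powr (1 / p)" if "t \<in> {0..1}" for t
  proof -
    have "V 0 \<le> V t" "V t \<le> V 1"
      using that by (auto intro!: monoD[OF mono])
    then have "\<bar>V t - V 0\<bar> powr (1 / p) \<le> (V 1 - V 0) powr (1 / p)"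
      using p by (intro powr_mono2) auto
    then show ?thesis
      using abs_le[of t 0] by linarith
  qed
  moreover have "(\<lambda>_. \<bar>g 0\<bar> + (V 1 - V 0) powr (1 / p)) integrable_on {0..1::real}"
    by (rule integrable_const_ivl)
  ultimately have "g integrable_on {0..1}"
    using measurable_bounded_by_integrable_imp_integrable
        [where f = g and S = "{0..1}" and g = "\<lambda>_. \<bar>g 0\<bar> + (V 1 - V 0) powr (1 / p)"] by simp
  then show ?thesis
    by (rule integrable_eq) (simp add: g_def)
qed

section \<open>Finite sums and subdivision of the integral\<close>

text \<open>Jensen's inequality, with \<open>B\<close> bounding the mean. Young's inequality is the
  tangent line of the concave power at \<open>B\<close>, scaled by \<open>B powr (1 - r)\<close>;
  cancelling this factor requires \<open>B \<noteq> 0\<close>.\<close>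

lemma sum_powr_le_concave:
  fixes s :: "nat \<Rightarrow> real"
  assumes r: "0 < r" "r \<le> 1" and s: "\<And>i. i < n \<Longrightarrow> 0 \<le> s i"
    and sum: "(\<Sum>i<n. s i) \<le> n * B" and B: "0 \<le> B"
  shows "(\<Sum>i<n. s i powr r) \<le> n * B powr r"
proof (cases "B = 0")
  case True
  then have "(\<Sum>i<n. s i) = 0"
    using sum s by (intro antisym sum_nonneg) auto
  then have "s i = 0" if "i < n" for i
    using that s sum_nonneg_eq_0_iff[of "{..<n}" s] by simp
  then show ?thesis
    using True by simp
next
  case False
  then have B: "0 < B" using B by simp
  have "s i powr r * B powr (1 - r) \<le> r * s i + (1 - r) * B" if "i < n" for i
    using Youngs_inequality_0[of r "1 - r" "s i" B] s[OF that] r B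
    by (cases "s i = 0") auto
  then have "(\<Sum>i<n. s i powr r * B powr (1 - r)) \<le> (\<Sum>i<n. r * s i + (1 - r) * B)"
    by (intro sum_mono) auto
  also have "\<dots> = r * (\<Sum>i<n. s i) + n * (1 - r) * B"
    by (simp add: sum.distrib sum_distrib_left)
  also have "\<dots> \<le> r * (n * B) + n * (1 - r) * B"
    using sum r by (simp add: mult_left_mono)
  also have "\<dots> = n * B powr r * B powr (1 - r)"
    using B by (simp add: algebra_simps flip: powr_add)
  finally have "(\<Sum>i<n. s i powr r) * B powr (1 - r) \<le> n * B powr r * B powr (1 - r)"
    by (simp add: sum_distrib_right)
  then show ?thesis
    using B by simp
qed

text \<open>Induction on the shift: each further unit adds a sum that telescopes to
  \<open>W (n + m) - W m\<close>, at most \<open>u - l\<close>.\<close>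

lemma sum_shift_diff_le:
  fixes W :: "nat \<Rightarrow> real"
  assumes "\<And>i. l \<le> W i" and "\<And>i. W i \<le> u"
  shows "(\<Sum>i<n. W (i + m) - W i) \<le> m * (u - l)"
proof (induction m)
  case (Suc m)
  have "(\<Sum>i<n. W (i + Suc m) - W i)
      = (\<Sum>i<n. W (Suc (i + m)) - W (i + m)) + (\<Sum>i<n. W (i + m) - W i)"
    by (simp flip: sum.distrib)
  also have "(\<Sum>i<n. W (Suc (i + m)) - W (i + m)) = W (n + m) - W m"
    using sum_lessThan_telescope[of "\<lambda>i. W (i + m)" n] by simp
  also have "W (n + m) - W m \<le> u - l"
    using assms[of "n + m"] assms[of m] by linarith
  finally show ?case
    using Suc.IH by (simp add: algebra_simps)
qed simp

text \<open>General \<open>k\<close> serves the induction; \<open>k = N\<close> splits the integral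
  into the grid cells.\<close>

lemma integral_equal_parts:
  fixes f :: "real \<Rightarrow> real" and k N :: nat
  assumes f: "f integrable_on {0..1}" and k: "k \<le> N"
  shows "integral {0..k / N} f = (\<Sum>i<k. integral {i / N..Suc i / N} f)"
  using k
proof (induction k)
  case (Suc k)
  have "f integrable_on {0..Suc k / N}"
    using f by (rule integrable_on_subinterval) (use Suc.prems in \<open>auto simp: divide_simps\<close>)
  then have "integral {0..k / N} f + integral {k / N..Suc k / N} f = integral {0..Suc k / N} f"
    by (intro Henstock_Kurzweil_Integration.integral_combine) (auto simp: divide_simps)
  then show ?case
    using Suc by simp
qed simp

section \<open>Discrepancy and sorted points\<close>

lemma hits_div_bounds: "0 \<le> hits N E x / N" "hits N E x / N \<le> 1"
proof -
  have "hits N E x \<le> (\<Sum>n=1..N. 1)"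
    unfolding hits_def by (intro sum_mono) (auto simp: indicator_def)
  then show "hits N E x / N \<le> 1"
    by (simp add: divide_simps)
  show "0 \<le> hits N E x / N"
    unfolding hits_def by (intro divide_nonneg_nonneg sum_nonneg) auto
qed

text \<open>A real supremum dominates its members once the set is bounded above. Here the frequency
  and \<open>b\<close> both lie in \<open>{0..1}\<close>, so 1 is a bound.\<close>

lemma abs_le_star_discrepancy:
  assumes "0 < b" "b \<le> 1"
  shows "\<bar>hits N {0..<b} x / N - b\<bar> \<le> star_discrepancy N x"
  unfolding star_discrepancy_def
proof (rule cSUP_upper)
  show "bdd_above ((\<lambda>b. \<bar>hits N {0..<b} x / N - b\<bar>) ` {0<..1})"
  proof (rule bdd_aboveI2)
    fix b :: real assume "b \<in> {0<..1}"
    then show "\<bar>hits N {0..<b} x / N - b\<bar> \<le> 1"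
      using hits_div_bounds[of N "{0..<b}" x] by auto
  qed
qed (use assms in auto)

text \<open>The sum depends only on the multiset of points. The index range changes from
  \<open>1..N\<close> to \<open>0..N-1\<close>.\<close>

lemma sum_nth_sort:
  fixes x :: "nat \<Rightarrow> real" and g :: "real \<Rightarrow> real" and N :: nat
  defines "y \<equiv> sort (map x [1..<Suc N])"
  shows "(\<Sum>n=1..N. g (x n)) = (\<Sum>i<N. g (y ! i))"
proof -
  have "(\<Sum>n=1..N. g (x n)) = sum_list (map g (map x [1..<Suc N]))"
    by (simp add: interv_sum_list_conv_sum_set_nat comp_def atLeastLessThanSuc_atLeastAtMost
             del: upt_Suc One_nat_def)
  also have "\<dots> = sum_list (map g y)"
    unfolding y_def by (metis mset_map mset_sort sum_mset_sum_list)
  also have "\<dots> = (\<Sum>i<N. g (y ! i))"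
    unfolding y_def by (simp add: sum_list_sum_nth atLeast0LessThan del: upt_Suc)
  finally show ?thesis .
qed

lemma sorted_near_grid:
  fixes x :: "nat \<Rightarrow> real"
  assumes x: "\<And>n. 1 \<le> n \<Longrightarrow> x n \<in> {0..1}" and i: "i < N"
  defines "y \<equiv> sort (map x [1..<Suc N])"
  shows "y ! i \<in> {0..1}" "Suc i / N - star_discrepancy N x \<le> y ! i"
    "y ! i \<le> i / N + star_discrepancy N x"
proof -
  define D where "D = star_discrepancy N x"
  have len: "length y = N" and sorted: "sorted y" and set: "set y = x ` {1..N}"
    unfolding y_def by auto
  have y01: "y ! j \<in> {0..1}" if "j < N" for j
  proof -
    have "y ! j \<in> x ` {1..N}"
      using that len set by (metis nth_mem)
    then show ?thesis using x by auto
  qed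
  then show y: "y ! i \<in> {0..1}" using i .
  have hits: "hits N {0..<b} x = card {j. j < N \<and> y ! j < b}" for b
  proof -
    have "hits N {0..<b} x = (\<Sum>j<N. indicator {0..<b} (y ! j))"
      unfolding hits_def y_def by (rule sum_nth_sort)
    also have "\<dots> = (\<Sum>j<N. if y ! j < b then 1 else 0)"
      using y01 by (intro sum.cong) (auto simp: indicator_def)
    also have "\<dots> = card {j. j < N \<and> y ! j < b}"
      by (simp add: sum.If_cases Int_def)
    finally show ?thesis .
  qed
  have D: "\<bar>hits N {0..<b} x / N - b\<bar> \<le> D" if "0 < b" "b \<le> 1" for b
    using abs_le_star_discrepancy that unfolding D_def .
  have D0: "0 \<le> D" using D[of 1] by simp
  \<comment> \<open>As \<open>{0..<b}\<close> is half-open, \<open>b\<close> must exceed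
    \<open>y ! i\<close> to count all \<open>i + 1\<close> points up to it; \<open>dense_ge\<close>
    then lets \<open>b\<close> decrease to \<open>y ! i\<close>. For \<open>b > 1\<close> the claim
    follows from \<open>Suc i / N \<le> 1\<close> and \<open>0 \<le> D\<close>.\<close>
  have "Suc i / N - D \<le> b" if b: "y ! i < b" for b
  proof (cases "b \<le> 1")
    case True
    have "{..i} \<subseteq> {j. j < N \<and> y ! j < b}"
      using sorted_nth_mono[OF sorted, of _ i] len i b by (auto intro: le_less_trans)
    then have "card {..i} \<le> card {j. j < N \<and> y ! j < b}"
      by (intro card_mono) auto
    then have "Suc i / N \<le> hits N {0..<b} x / N"
      unfolding hits by (intro divide_right_mono) auto
    then show ?thesis
      using D[of b] True b y by auto
  next
    case False
    moreover have "Suc i / N \<le> 1" using i by (simp add: divide_simps)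
    ultimately show ?thesis using D0 by linarith
  qed
  then show "Suc i / N - star_discrepancy N x \<le> y ! i"
    unfolding D_def by (rule dense_ge)
  \<comment> \<open>Here \<open>b = y ! i\<close> itself works: only indices below \<open>i\<close>
    can give strictly smaller points. The discrepancy tests only \<open>b > 0\<close>, hence the
    case split.\<close>
  show "y ! i \<le> i / N + star_discrepancy N x"
  proof (cases "y ! i = 0")
    case False
    have "{j. j < N \<and> y ! j < y ! i} \<subseteq> {..<i}"
      using sorted_nth_mono[OF sorted, of i] len by (auto simp: not_less[symmetric])
    then have "card {j. j < N \<and> y ! j < y ! i} \<le> card {..<i}"
      by (intro card_mono) auto
    then have "hits N {0..<y ! i} x / N \<le> i / N"
      unfolding hits by (intro divide_right_mono) auto
    then show ?thesis
      using D[of "y ! i"] False y unfolding D_def by auto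
  qed (use D0 in \<open>auto simp: D_def\<close>)
qed

section \<open>The error estimate\<close>

lemma quad_error_le:
  fixes V f :: "real \<Rightarrow> real" and x :: "nat \<Rightarrow> real"
  assumes p: "1 \<le> p" and mono: "mono V" and V0: "\<And>t. 0 \<le> V t" and VK: "\<And>t. V t \<le> K"
    and inc: "\<And>s t. 0 \<le> s \<Longrightarrow> s \<le> t \<Longrightarrow> t \<le> 1 \<Longrightarrow> \<bar>f t - f s\<bar> powr p \<le> V t - V s"
    and x: "\<And>n. 1 \<le> n \<Longrightarrow> x n \<in> {0..1}" and N: "1 \<le> N"
  shows "quad_error N f x \<le> 4 * N powr (1 - 1 / p) * star_discrepancy N x * K powr (1 / p)"
proof -
  define D where "D = star_discrepancy N x"
  define y where "y = sort (map x [1..<Suc N])"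
  have y01: "y ! i \<in> {0..1}" and ylo: "Suc i / N - D \<le> y ! i" and yhi: "y ! i \<le> i / N + D"
    if "i < N" for i
    using sorted_near_grid[OF x that] unfolding y_def D_def by auto
  \<comment> \<open>The two bounds on \<open>y ! 0\<close> are compatible only if
    \<open>1 / N - D \<le> D\<close>. This puts each cell within \<open>D\<close> of its midpoint
    and makes \<open>m\<close> positive.\<close>
  have D: "1 / (2 * N) \<le> D"
  proof -
    have "1 / N \<le> 2 * D"
      using ylo[of 0] yhi[of 0] N by simp
    then show ?thesis by simp
  qed
  define c where "c i = (2 * real i + 1) / (2 * N)" for i
  define m where "m = nat \<lceil>2 * N * D\<rceil>"
  have half: "0 \<le> 1 / (2 * real N)"
    by simp
  have NDge: "1 \<le> 2 * N * D"
    using D N by (simp add: field_simps)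
  \<comment> \<open>Rounding up a number that is at least 1 at most doubles it; this produces the
    constant 4.\<close>
  have m_ge: "2 * N * D \<le> m" and m_le: "m \<le> 4 * N * D" and m_pos: "1 \<le> m"
    using NDge unfolding m_def by linarith+
  define W where "W i = V (c i - D)" for i
  define s where "s i = W (i + m) - W i" for i
  have f_int: "f integrable_on {0..1}"
    using p mono inc by (rule integrable_increment_bound)
  \<comment> \<open>Midpoints \<open>m\<close> indices apart are \<open>m / N \<ge> 2 * D\<close>
    apart, so window \<open>i\<close> ends before window \<open>i + m\<close> begins, and
    \<open>s i\<close> dominates the growth of \<open>V\<close> across window
    \<open>i\<close>.\<close>
  have c_shift: "c i + D \<le> c (i + m) - D" for i
    using m_ge N by (simp add: c_def field_simps)
  have W_mono: "W i \<le> W (i + m)" for i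
    unfolding W_def using c_shift[of i] D half by (intro monoD[OF mono]) linarith
  have near: "\<bar>f u - f t\<bar> \<le> s i powr (1 / p)"
    if "u \<in> {0..1}" "t \<in> {0..1}" "u \<in> {c i - D..c i + D}" "t \<in> {c i - D..c i + D}" for u t i
  proof -
    have *: "\<bar>f t - f u\<bar> powr p \<le> s i"
      if ut: "0 \<le> u" "u \<le> t" "t \<le> 1" "c i - D \<le> u" "t \<le> c i + D" for u t
    proof -
      have "V t \<le> W (i + m)" "W i \<le> V u"
        unfolding W_def using ut c_shift[of i] by (auto intro!: monoD[OF mono])
      then show ?thesis
        using inc[OF ut(1-3)] unfolding s_def by linarith
    qed
    have "\<bar>f u - f t\<bar> powr p \<le> s i"
      using *[of u t] *[of t u] that by (cases "u \<le> t") (auto simp: abs_minus_commute)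
    then have "(\<bar>f u - f t\<bar> powr p) powr (1 / p) \<le> s i powr (1 / p)"
      using p by (intro powr_mono2) auto
    then show ?thesis
      using p by (simp add: powr_powr)
  qed
  have cell: "\<bar>f (y ! i) / N - integral {i / N..Suc i / N} f\<bar> \<le> s i powr (1 / p) / N"
    if i: "i < N" for i
  proof -
    let ?J = "{i / N..Suc i / N}"
    have len: "Suc i / N - i / N = 1 / N"
      by (simp add: add_divide_distrib)
    have c1: "c i = i / N + 1 / (2 * N)" and c2: "c i = Suc i / N - 1 / (2 * N)"
      using N by (simp_all add: c_def field_simps)
    have sub: "?J \<subseteq> {0..1}"
      using i by (auto simp: divide_simps intro: order_trans)
    have le: "i / N \<le> Suc i / N"
      by (simp add: divide_simps)
    have "f integrable_on ?J"
      using f_int sub by (rule integrable_on_subinterval)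
    then have "((\<lambda>t. f (y ! i) - f t) has_integral (f (y ! i) / N - integral ?J f)) ?J"
      using has_integral_diff[OF has_integral_const_real[of "f (y ! i)" "i / N" "Suc i / N"]
          integrable_integral] le len by simp
    moreover have "\<bar>f (y ! i) - f t\<bar> \<le> s i powr (1 / p)" if "t \<in> ?J" for t
    proof (rule near)
      show "y ! i \<in> {c i - D..c i + D}"
        using ylo[OF i] yhi[OF i] c1 c2 half unfolding atLeastAtMost_iff by linarith
      show "t \<in> {c i - D..c i + D}"
        using that c1 c2 D unfolding atLeastAtMost_iff by linarith
    qed (use y01[OF i] subsetD[OF sub that] in auto)
    ultimately have "norm (f (y ! i) / N - integral ?J f) \<le> s i powr (1 / p) * measure lborel ?J"
      by (intro has_integral_bound_real[where S = "{}"]) auto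
    then show ?thesis
      using le len by simp
  qed
  have "quad_error N f x
      = \<bar>(\<Sum>i<N. f (y ! i) / N) - (\<Sum>i<N. integral {i / N..Suc i / N} f)\<bar>"
    using sum_nth_sort[of f x N] integral_equal_parts[OF f_int order_refl, of N] N
    unfolding quad_error_def y_def by (simp add: sum_divide_distrib)
  also have "\<dots> \<le> (\<Sum>i<N. s i powr (1 / p) / N)"
    unfolding sum_subtractf[symmetric] using cell by (intro sum_abs[THEN order_trans] sum_mono) auto
  also have "\<dots> = (\<Sum>i<N. s i powr (1 / p)) / N"
    by (simp add: sum_divide_distrib)
  \<comment> \<open>Telescoping with shift \<open>m\<close> bounds the mean of the
    \<open>s i\<close> by \<open>m / N * K\<close>.\<close>
  also have "\<dots> \<le> N * (m / N * K) powr (1 / p) / N"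
  proof (intro divide_right_mono sum_powr_le_concave)
    show "(\<Sum>i<N. s i) \<le> N * (m / N * K)"
      using sum_shift_diff_le[of 0 W K m N] V0 VK N unfolding s_def W_def by simp
    show "0 \<le> m / N * K"
      using order_trans[OF V0 VK] by simp
  qed (use p W_mono in \<open>auto simp: s_def\<close>)
  also have "\<dots> = (m / N) powr (1 / p) * K powr (1 / p)"
    using N order_trans[OF V0 VK] powr_mult[of "m / N" K "1 / p"] by simp
  also have "\<dots> \<le> 4 * N powr (1 - 1 / p) * D * K powr (1 / p)"
  proof (rule mult_right_mono)
    \<comment> \<open>One full factor \<open>m / N\<close> is split off to become linear in
      \<open>D\<close>. The remaining exponent is nonpositive, so \<open>m / N \<ge> 1 / N\<close>
      turns the rest into \<open>N powr (1 - 1 / p)\<close>.\<close>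
    have "(m / N) powr (1 / p) = (m / N) * (m / N) powr - (1 - 1 / p)"
      using powr_mult_base[of "m / N" "- (1 - 1 / p)"] by simp
    also have "\<dots> \<le> (m / N) * (1 / N) powr - (1 - 1 / p)"
      using m_pos N p by (intro mult_left_mono powr_mono2') (auto simp: divide_simps)
    also have "(1 / N) powr - (1 - 1 / p) = N powr (1 - 1 / p)"
      using N powr_minus_divide[of "real N" "1 / p - 1"] by (simp add: powr_divide)
    also have "m / N * N powr (1 - 1 / p) \<le> 4 * D * N powr (1 - 1 / p)"
      using m_le N by (intro mult_right_mono) (auto simp: field_simps)
    finally show "(m / N) powr (1 / p) \<le> 4 * N powr (1 - 1 / p) * D"
      by (simp add: mult_ac)
  qed simp
  finally show ?thesis
    unfolding D_def .
qed

theorem corollary1p3: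
  fixes p :: real and f :: "real \<Rightarrow> real"
  assumes "1 \<le> p" and "f \<in> BV p"
  shows "\<exists>C::real. C > 0 \<and>
    (\<forall>x :: nat \<Rightarrow> real. (\<forall>n\<ge>1. x n \<in> {0..1}) \<longrightarrow>
      (\<forall>N::nat. N \<ge> 1 \<longrightarrow>
        ereal (quad_error N f x)
          \<le> ereal (C * real N powr (1 - 1 / p) * star_discrepancy N x) * Var p f))"
proof -
  have "Var p f < \<infinity>"
    using assms(2) by (simp add: BV_def)
  then obtain v where v: "Var p f = ereal v" and v0: "0 \<le> v"
    using Var_nonneg[of p f] by (cases "Var p f") auto
  obtain V where V: "mono V" "\<And>t. 0 \<le> V t" "\<And>t. V t \<le> v powr p"
    "\<And>s t. 0 \<le> s \<Longrightarrow> s \<le> t \<Longrightarrow> t \<le> 1 \<Longrightarrow> \<bar>f t - f s\<bar> powr p \<le> V t - V s"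
    using BV_increment_bound[OF assms(1) v] by blast
  \<comment> \<open>The estimate is applied with \<open>K = v powr p\<close>, whose
    \<open>p\<close>-th root is the variation itself.\<close>
  have "(v powr p) powr (1 / p) = v"
    using assms(1) v0 by (simp add: powr_powr)
  then have "quad_error N f x \<le> 4 * N powr (1 - 1 / p) * star_discrepancy N x * v"
    if "\<forall>n\<ge>1. x n \<in> {0..1}" "1 \<le> N" for x N
    using quad_error_le[OF assms(1) V, of x N] that by simp
  then show ?thesis
    unfolding v by (intro exI[of _ 4]) simp
qed

end
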